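(* Let $\alpha>0$, $\lambda\in\mathbb{R}$, $t_0<T$, $h>0$, $t_i=t_0+ih$, let $n\ge1$ be an integer with $t_n\le T$, and let $d\ge0$ be an integer. Let $f\in C^{d}([t_0,T])$ and assume that, for every $j=0,\dots,n-1$, $f^{(d+1)}$ exists and is continuous on the open interval $(t_j,t_{j+1})$ and the quadrature rule $\mathcal{Q}_{n,j}$ has degree of precision $d$. Then $$y(t_n)-y_n = h^{d+1}\sum_{j=0}^{n-1}\int_0^1 f^{(d+1)}(t_j+uh)\left(h^\alpha R_{\alpha,\alpha,d}(n-j,u,1;h^\alpha\lambda)-\sum_{r=1}^{\nu} b_r(n-j)\frac{(c_r-u)_+^{d}}{d!}\right)du .$$
   Context: $E_{\alpha,\beta}(z)=\sum_{k=0}^\infty \frac{z^k}{\Gamma(\alpha k+\beta)}$ is the Mittag--Leffler function and $e_{\alpha,\beta}(t;z)=t^{\beta-1}E_{\alpha,\beta}(-t^\alpha z)$. For $a<b\le t$ and an integer $k\ge0$, $R_{\alpha,\beta,k}(t,a,b;z)=\frac{1}{\Gamma(k+1)}\int_a^b e_{\alpha,\beta}(t-s;z)(s-a)^k\,ds$. For real $x$ and integer $k\ge0$, $(x)_+^k=x^k$ if $x\ge0$ and $(x)_+^k=0$ if $x<0$, with $0^0=1$. Let $m=\lceil\alpha\rceil$ and let $y_{0,0},\dots,y_{0,m-1}\in\mathbb{R}$ be given initial data. The function $y$ is the solution on $[t_0,T]$ of the linear fractional differential equation $D^\alpha_{t_0}y(t)+\lambda y(t)=f(t)$ (Caputo derivative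 of order $\alpha$ with origin $t_0$), $y^{(k)}(t_0)=y_{0,k}$ for $k=0,\dots,m-1$, that is, the function given by $$y(t)=\sum_{k=0}^{m-1}e_{\alpha,k+1}(t-t_0;\lambda)\,y_{0,k}+\int_{t_0}^t e_{\alpha,\alpha}(t-s;\lambda)f(s)\,ds .$$ Fix nodes $c_1,\dots,c_\nu\in[0,1]$ and real weights $b_r(n-j)$ (which may depend on $\alpha,\lambda,h$). For $0\le j\le n-1$ put $\mathcal{I}_j[g,t_n]=\int_{t_j}^{t_{j+1}}e_{\alpha,\alpha}(t_n-s;\lambda)g(s)\,ds$ and $\mathcal{Q}_{n,j}[g]=\sum_{r=1}^\nu b_r(n-j)\,g(t_j+c_rh)$. The rule $\mathcal{Q}_{n,j}$ has degree of precision $d$ if $\mathcal{I}_j[p,t_n]=\mathcal{Q}_{n,j}[p]$ for every polynomial $p$ of degree not exceeding $d$, but this fails for polynomials of degree $d+1$. The numerical approximation is $$y_n=\sum_{k=0}^{m-1}e_{\alpha,k+1}(t_n-t_0;\lambda)\,y_{0,k}+\sum_{j=0}^{n-1}\sum_{r=1}^{\nu}b_r(n-j)\,f(t_j+c_rh).$$ Integrals involving $f^{(d+1)}$ are understood as improper at the endpoints of the interval if necessary. *)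

theory Defs
  imports "HOL-Analysis.Analysis" "HOL-Computational_Algebra.Polynomial"
begin

(* All integrals are Henstock-Kurzweil integrals. By Hake's theorem this integral
   includes the improper Riemann integral (also a conditionally convergent one),
   and endpoint values of the integrand do not matter. *)

(* The parameter called lambda in D^\<alpha> y + lambda y = f is written \<mu> throughout. *)

definition mittag_leffler :: "real \<Rightarrow> real \<Rightarrow> real \<Rightarrow> real" where
  "mittag_leffler \<alpha> \<beta> z = (\<Sum>k. z ^ k / Gamma (\<alpha> * real k + \<beta>))"

(* Unlike powr, this satisfies 0^0 = 1; so e_{\<alpha>,1}(0;z) = 1 and the solution
   below takes the value y0 0 at the origin. *)
definition rpow :: "real \<Rightarrow> real \<Rightarrow> real" where
  "rpow x a = (if a = 0 then 1 else x powr a)"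

definition ml_e :: "real \<Rightarrow> real \<Rightarrow> real \<Rightarrow> real \<Rightarrow> real" where
  "ml_e \<alpha> \<beta> t z = rpow t (\<beta> - 1) * mittag_leffler \<alpha> \<beta> (- rpow t \<alpha> * z)"

definition ml_R :: "real \<Rightarrow> real \<Rightarrow> nat \<Rightarrow> real \<Rightarrow> real \<Rightarrow> real \<Rightarrow> real \<Rightarrow> real" where
  "ml_R \<alpha> \<beta> k t a b z =
     1 / Gamma (real k + 1) * integral {a..b} (\<lambda>s. ml_e \<alpha> \<beta> (t - s) z * (s - a) ^ k)"

definition trunc_pow :: "real \<Rightarrow> nat \<Rightarrow> real" where
  "trunc_pow x k = (if x \<ge> 0 then x ^ k else 0)"

(* Derivatives are taken within S, hence one-sided at the endpoints of an interval S. *)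
primrec nth_deriv_within :: "nat \<Rightarrow> (real \<Rightarrow> real) \<Rightarrow> real set \<Rightarrow> real \<Rightarrow> real" where
  "nth_deriv_within 0 f S = f"
| "nth_deriv_within (Suc k) f S =
     (\<lambda>t. vector_derivative (nth_deriv_within k f S) (at t within S))"

definition C_k_on :: "nat \<Rightarrow> (real \<Rightarrow> real) \<Rightarrow> real set \<Rightarrow> bool" where
  "C_k_on d f S \<longleftrightarrow> (\<forall>k<d. nth_deriv_within k f S differentiable_on S) \<and>
     continuous_on S (nth_deriv_within d f S)"

definition mesh :: "real \<Rightarrow> real \<Rightarrow> nat \<Rightarrow> real" where
  "mesh t0 h i = t0 + real i * h"

(* The solution, in closed form, of the Caputo problem D^\<alpha> y + \<mu> y = f
   with y^(k)(t0) = y0 k for k < \<lceil>\<alpha>\<rceil>. *)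
definition fde_solution ::
  "real \<Rightarrow> real \<Rightarrow> real \<Rightarrow> (nat \<Rightarrow> real) \<Rightarrow> (real \<Rightarrow> real) \<Rightarrow> real \<Rightarrow> real" where
  "fde_solution \<alpha> \<mu> t0 y0 f t =
     (\<Sum>k<nat \<lceil>\<alpha>\<rceil>. ml_e \<alpha> (real k + 1) (t - t0) \<mu> * y0 k) +
     integral {t0..t} (\<lambda>s. ml_e \<alpha> \<alpha> (t - s) \<mu> * f s)"

definition quad_integral ::
  "real \<Rightarrow> real \<Rightarrow> real \<Rightarrow> real \<Rightarrow> nat \<Rightarrow> nat \<Rightarrow> (real \<Rightarrow> real) \<Rightarrow> real" where
  "quad_integral \<alpha> \<mu> t0 h n j g =
     integral {mesh t0 h j..mesh t0 h (Suc j)} (\<lambda>s. ml_e \<alpha> \<alpha> (mesh t0 h n - s) \<mu> * g s)"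

(* b r i is the weight b_r(i); nodes and weights are indexed by r = 1..\<nu>. *)
definition quad_rule ::
  "nat \<Rightarrow> (nat \<Rightarrow> real) \<Rightarrow> (nat \<Rightarrow> nat \<Rightarrow> real) \<Rightarrow> real \<Rightarrow> real \<Rightarrow> nat \<Rightarrow> nat \<Rightarrow>
   (real \<Rightarrow> real) \<Rightarrow> real" where
  "quad_rule \<nu> c b t0 h n j g = (\<Sum>r=1..\<nu>. b r (n - j) * g (mesh t0 h j + c r * h))"

(* Once the rule is exact up to degree d, one failing polynomial of degree d + 1
   means that all of them fail. *)
definition degree_of_precision ::
  "((real \<Rightarrow> real) \<Rightarrow> real) \<Rightarrow> ((real \<Rightarrow> real) \<Rightarrow> real) \<Rightarrow> nat \<Rightarrow> bool" where
  "degree_of_precision I Q d \<longleftrightarrow>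
     (\<forall>p :: real poly. degree p \<le> d \<longrightarrow> I (poly p) = Q (poly p)) \<and>
     \<not> (\<forall>p :: real poly. degree p = Suc d \<longrightarrow> I (poly p) = Q (poly p))"

definition numerical_solution ::
  "real \<Rightarrow> real \<Rightarrow> real \<Rightarrow> (nat \<Rightarrow> real) \<Rightarrow> nat \<Rightarrow> (nat \<Rightarrow> real) \<Rightarrow> (nat \<Rightarrow> nat \<Rightarrow> real) \<Rightarrow> real \<Rightarrow>
   (real \<Rightarrow> real) \<Rightarrow> nat \<Rightarrow> real" where
  "numerical_solution \<alpha> \<mu> t0 y0 \<nu> c b h f n =
     (\<Sum>k<nat \<lceil>\<alpha>\<rceil>. ml_e \<alpha> (real k + 1) (mesh t0 h n - t0) \<mu> * y0 k) +
     (\<Sum>j<n. \<Sum>r=1..\<nu>. b r (n - j) * f (mesh t0 h j + c r * h))"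

end

theory Submission
  imports Defs
begin

text \<open>This is the Peano kernel argument, arranged so that Fubini's theorem is not needed: the
  derivative of order d + 1 is only conditionally integrable in general. On each panel one subtracts
  from f its Taylor polynomial of degree d at the left end, on which the rule is exact. The difference
  has vanishing derivatives up to order d at the left end, and the iterated integrals of the weight
  taken from the right end vanish there, so d + 1 integrations by parts without boundary terms move
  all derivatives onto f; each step is an application of the fundamental theorem of calculus with a
  primitive that is continuous on the closed panel. The same integration by parts gives the
  remainder at the nodes and identifies the iterated integrals of the weight with R.\<close>

section \<open>Convergence and continuity of the Mittag-Leffler series\<close>

text \<open>Euler's integrand is nonnegative, so its part over \<open>{M..M + 1}\<close> is a lower
  bound. As \<open>M\<close> is arbitrary, Gamma outgrows every exponential, which is what makes the
  series converge for every argument.\<close>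

lemma Gamma_ge_powr:
  fixes x M :: real
  assumes "x \<ge> 1" "M > 0"
  shows "M powr (x - 1) / exp (M + 1) \<le> Gamma x"
proof -
  define g where "g t = t powr (x - 1) / exp t" for t
  have Gamma: "(g has_integral Gamma x) {0..}"
    unfolding g_def using assms by (intro Gamma_integral_real) auto
  have sub: "{M..M + 1} \<subseteq> {0..}"
    using assms by auto
  have g: "g integrable_on {M..M + 1}"
    using has_integral_integrable[OF Gamma] sub by (rule integrable_on_subinterval)
  have "((\<lambda>_. M powr (x - 1) / exp (M + 1)) has_integral (M powr (x - 1) / exp (M + 1))) {M..M + 1}"
    using has_integral_const_real[of "M powr (x - 1) / exp (M + 1)" M "M + 1"] by simp
  hence "M powr (x - 1) / exp (M + 1) \<le> integral {M..M + 1} g"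
  proof (rule has_integral_le[OF _ integrable_integral[OF g]])
    fix t assume "t \<in> {M..M + 1}"
    thus "M powr (x - 1) / exp (M + 1) \<le> g t"
      unfolding g_def using assms by (intro frac_le powr_mono2) auto
  qed
  also have "integral {M..M + 1} g \<le> Gamma x"
    by (rule has_integral_subset_le[OF sub integrable_integral[OF g] Gamma]) (simp add: g_def)
  finally show ?thesis .
qed

lemma summable_mittag_leffler:
  fixes \<alpha> \<beta> z :: real
  assumes "\<alpha> > 0"
  shows "summable (\<lambda>k. 1 / Gamma (\<alpha> * real k + \<beta>) * z ^ k)"
proof -
  \<comment> \<open>Chosen so that the k-th denominator grows like
    \<open>(2 * (\<bar>z\<bar> + 1)) ^ k\<close>, which leaves a geometric series of ratio 1/2. The
    added 1 keeps \<open>M\<close> positive when \<open>z = 0\<close>.\<close>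
  define M where "M = (2 * (\<bar>z\<bar> + 1)) powr (1 / \<alpha>)"
  have M: "M > 0" "M powr \<alpha> = 2 * (\<bar>z\<bar> + 1)"
    using assms by (auto simp: M_def powr_powr)
  define C where "C = exp (M + 1) * M powr (1 - \<beta>)"
  \<comment> \<open>The Gamma bound needs argument at least 1. Only finitely many indices are lost,
    among them any poles of Gamma, where the convention \<open>1 / 0 = 0\<close> gives the right
    coefficient.\<close>
  have "eventually (\<lambda>k. \<alpha> * real k + \<beta> \<ge> 1) sequentially"
  proof -
    have "filterlim (\<lambda>k. \<beta> + \<alpha> * real k) at_top sequentially"
      using assms by (intro filterlim_tendsto_add_at_top[OF tendsto_const]
        filterlim_tendsto_pos_mult_at_top[OF tendsto_const] filterlim_real_sequentially)
    thus ?thesis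
      by (auto simp: filterlim_at_top add.commute)
  qed
  moreover have "norm (1 / Gamma (\<alpha> * real k + \<beta>) * z ^ k) \<le> C * (1 / 2) ^ k"
    if k: "\<alpha> * real k + \<beta> \<ge> 1" for k
  proof -
    have "M powr (\<alpha> * real k + \<beta> - 1) / exp (M + 1) \<le> Gamma (\<alpha> * real k + \<beta>)"
      using Gamma_ge_powr[OF k M(1)] by simp
    moreover have "M powr (\<alpha> * real k + \<beta> - 1) / exp (M + 1) > 0"
      using M by simp
    ultimately have "1 / Gamma (\<alpha> * real k + \<beta>) \<le> 1 / (M powr (\<alpha> * real k + \<beta> - 1) / exp (M + 1))"
      by (intro frac_le) auto
    also have "M powr (\<alpha> * real k + \<beta> - 1) = (M powr \<alpha>) ^ k * M powr (\<beta> - 1)"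
      using M(1) by (simp add: powr_add[symmetric] powr_realpow[symmetric] powr_powr algebra_simps)
    also have "1 / ((M powr \<alpha>) ^ k * M powr (\<beta> - 1) / exp (M + 1)) = C / (2 * (\<bar>z\<bar> + 1)) ^ k"
      using M by (simp add: C_def field_simps powr_diff)
    finally have *: "1 / Gamma (\<alpha> * real k + \<beta>) \<le> C / (2 * (\<bar>z\<bar> + 1)) ^ k" .
    have G: "Gamma (\<alpha> * real k + \<beta>) > 0"
      using k by (intro Gamma_real_pos) auto
    have "norm (1 / Gamma (\<alpha> * real k + \<beta>) * z ^ k) = 1 / Gamma (\<alpha> * real k + \<beta>) * \<bar>z\<bar> ^ k"
      using G by (simp add: abs_mult power_abs)
    also have "\<dots> \<le> C / (2 * (\<bar>z\<bar> + 1)) ^ k * (\<bar>z\<bar> + 1) ^ k"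
      using G M(1) * by (intro mult_mono power_mono) (auto simp: C_def)
    also have "\<dots> = C * (1 / 2) ^ k"
      by (simp add: power_mult_distrib power_one_over del: distrib_left_numeral)
    finally show ?thesis .
  qed
  ultimately have "eventually (\<lambda>k. norm (1 / Gamma (\<alpha> * real k + \<beta>) * z ^ k) \<le> C * (1 / 2) ^ k) sequentially"
    by (auto elim: eventually_mono)
  thus ?thesis
    by (rule summable_comparison_test_ev) (intro summable_mult summable_geometric, simp)
qed

lemma isCont_mittag_leffler:
  fixes \<alpha> \<beta> z :: real
  assumes "\<alpha> > 0"
  shows "isCont (mittag_leffler \<alpha> \<beta>) z"
proof -
  have "isCont (\<lambda>z. \<Sum>k. 1 / Gamma (\<alpha> * real k + \<beta>) * z ^ k) z"
    by (rule isCont_powser_converges_everywhere) (rule summable_mittag_leffler[OF assms])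
  thus ?thesis
    by (simp add: mittag_leffler_def[abs_def])
qed

lemma continuous_on_mittag_leffler [continuous_intros]:
  fixes \<alpha> \<beta> :: real
  assumes "\<alpha> > 0" "continuous_on S g"
  shows "continuous_on S (\<lambda>x. mittag_leffler \<alpha> \<beta> (g x))"
  using assms by (intro continuous_on_compose2[OF _ assms(2), of UNIV])
    (auto intro!: continuous_at_imp_continuous_on isCont_mittag_leffler)

section \<open>Integrability and scaling of the kernel \<open>ml_e\<close>\<close>

text \<open>The origin is excluded because \<open>rpow t (\<beta> - 1)\<close> is unbounded near 0
  for \<beta> < 1.\<close>

lemma continuous_on_ml_e:
  fixes \<alpha> \<beta> z :: real
  assumes "\<alpha> > 0" "S \<subseteq> {0<..}"
  shows "continuous_on S (\<lambda>t. ml_e \<alpha> \<beta> t z)"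
proof -
  have "continuous_on S (\<lambda>t. rpow t a)" for a
  proof (cases "a = 0")
    case False
    thus ?thesis
      using assms(2) unfolding rpow_def by (auto intro!: continuous_intros)
  qed (simp add: rpow_def)
  thus ?thesis
    unfolding ml_e_def using assms(1) by (intro continuous_intros)
qed

lemma absolutely_integrable_continuous_mult:
  fixes g w :: "real \<Rightarrow> real"
  assumes "continuous_on {a..b} g" "w absolutely_integrable_on {a..b}"
  shows "(\<lambda>x. g x * w x) absolutely_integrable_on {a..b}"
  using assms by (intro absolutely_integrable_bounded_measurable_product_real
    continuous_imp_measurable_on_sets_lebesgue compact_imp_bounded compact_continuous_image) auto

text \<open>The singularity at 0 has exponent \<beta> - 1 > -1, hence is integrable, and the
  Mittag-Leffler factor is continuous up to 0 because \<alpha> > 0.\<close>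

lemma absolutely_integrable_ml_e:
  fixes \<alpha> \<beta> z c :: real
  assumes "\<alpha> > 0" "\<beta> > 0" "0 \<le> a"
  shows "(\<lambda>t. ml_e \<alpha> \<beta> t z) absolutely_integrable_on {a..b}"
proof -
  define c where "c = max 0 b"
  have "(\<lambda>t. t powr (\<beta> - 1)) integrable_on {0..c}"
    using assms has_integral_powr_from_0[of "\<beta> - 1" c] by (auto simp: c_def has_integral_integrable)
  \<comment> \<open>\<open>rpow\<close> and \<open>powr\<close> differ only at base 0 with exponent
    0, that is, at one point when \<beta> = 1.\<close>
  hence "(\<lambda>t. rpow t (\<beta> - 1)) integrable_on {0..c}"
    by (rule integrable_spike[where S = "{0}"]) (auto simp: rpow_def)
  hence 1: "(\<lambda>t. rpow t (\<beta> - 1)) absolutely_integrable_on {0..c}"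
    by (rule nonnegative_absolutely_integrable_1) (auto simp: rpow_def)
  have "continuous_on {0..c} (\<lambda>t. rpow t \<alpha>)"
    using assms unfolding rpow_def by (simp, intro continuous_on_powr' continuous_intros) auto
  hence 2: "continuous_on {0..c} (\<lambda>t. mittag_leffler \<alpha> \<beta> (- rpow t \<alpha> * z))"
    using assms by (intro continuous_intros)
  have "(\<lambda>t. mittag_leffler \<alpha> \<beta> (- rpow t \<alpha> * z) * rpow t (\<beta> - 1)) absolutely_integrable_on {0..c}"
    using 1 2 by (intro absolutely_integrable_continuous_mult)
  hence "(\<lambda>t. ml_e \<alpha> \<beta> t z) absolutely_integrable_on {0..c}"
    by (simp add: ml_e_def[abs_def] mult.commute)
  thus ?thesis
    by (rule absolutely_integrable_on_subinterval) (use assms in \<open>auto simp: c_def\<close>)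
qed

lemma absolutely_integrable_reflected_ml_e:
  fixes \<alpha> \<beta> z N a b :: real
  assumes "\<alpha> > 0" "\<beta> > 0" "b \<le> N"
  shows "(\<lambda>s. ml_e \<alpha> \<beta> (N - s) z) absolutely_integrable_on {a..b}"
proof -
  let ?e = "\<lambda>t. ml_e \<alpha> \<beta> t z"
  have e: "?e absolutely_integrable_on {N - b..N - a}"
    using assms by (intro absolutely_integrable_ml_e) auto
  \<comment> \<open>Plain integrability is transported by reflection; using this for
    \<open>?e\<close> and for its norm gives absolute integrability.\<close>
  have refl: "(\<lambda>s. g (N - s)) integrable_on {a..b}" if "g integrable_on {N - b..N - a}" for g :: "real \<Rightarrow> real"
  proof -
    have "g integrable_on cbox (N - b) (N - a)"
      using that by simp
    moreover have "{a..b} = (\<lambda>x. (1 / (-1)) *\<^sub>R x - ((1 / (-1)) *\<^sub>R N)) ` cbox (N - b) (N - a)"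
      by (auto simp: image_iff intro!: bexI[of _ "N - _"])
    ultimately show ?thesis
      using integrable_on_affinity[of "-1" g "N - b" "N - a" N] by (simp add: algebra_simps)
  qed
  show ?thesis
    using refl[of ?e] refl[of "\<lambda>t. norm (?e t)"] e
    by (auto simp: absolutely_integrable_on_def)
qed

text \<open>\<open>rpow\<close> is multiplicative in its base here, also at \<open>x = 0\<close> and
  for exponent 0. This is where the parameter \<open>h powr \<alpha> * \<mu>\<close> of the kernel
  on the unit panel comes from.\<close>

lemma ml_e_scale:
  fixes \<alpha> z h x :: real
  assumes "h > 0" "x \<ge> 0"
  shows "ml_e \<alpha> \<beta> (h * x) z = h powr (\<beta> - 1) * ml_e \<alpha> \<beta> x (h powr \<alpha> * z)"
proof -
  have "rpow (h * x) a = h powr a * rpow x a" for a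
    using assms by (auto simp: rpow_def powr_mult)
  thus ?thesis
    by (simp add: ml_e_def mult_ac)
qed

section \<open>Repeated integration by parts and iterated integrals\<close>

text \<open>The boundary terms vanish at \<open>a\<close> through \<open>\<phi>\<close> and at
  \<open>b\<close> through \<open>\<psi>\<close>. Only the first product is assumed integrable;
  integrability of the last is part of the conclusion, and \<open>\<phi> m\<close> and
  \<open>\<psi> 0\<close> may be singular at the ends.\<close>

lemma iterated_integration_by_parts:
  fixes \<phi> \<psi> :: "nat \<Rightarrow> real \<Rightarrow> real" and a b I :: real
  assumes "a \<le> b"
    and "\<And>k. k < m \<Longrightarrow> continuous_on {a..b} (\<phi> k)"
    and "\<And>k x. k < m \<Longrightarrow> x \<in> {a<..<b} \<Longrightarrow> (\<phi> k has_real_derivative \<phi> (Suc k) x) (at x)"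
    and "\<And>k. k < m \<Longrightarrow> \<phi> k a = 0"
    and "\<And>k. k < m \<Longrightarrow> continuous_on {a..b} (\<psi> (Suc k))"
    and "\<And>k x. k < m \<Longrightarrow> x \<in> {a<..<b} \<Longrightarrow> (\<psi> (Suc k) has_real_derivative - \<psi> k x) (at x)"
    and "\<And>k. k < m \<Longrightarrow> \<psi> (Suc k) b = 0"
    and "((\<lambda>x. \<phi> 0 x * \<psi> 0 x) has_integral I) {a..b}"
  shows "((\<lambda>x. \<phi> m x * \<psi> m x) has_integral I) {a..b}"
  using assms
proof (induction m)
  case 0
  thus ?case by simp
next
  case (Suc m)
  \<comment> \<open>The primitive \<open>\<phi> m x * \<psi> (Suc m) x\<close> is continuous on the
    closed interval, so derivatives in the interior suffice.\<close>
  have "((\<lambda>x. \<phi> (Suc m) x * \<psi> (Suc m) x - \<phi> m x * \<psi> m x) has_integral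
      \<phi> m b * \<psi> (Suc m) b - \<phi> m a * \<psi> (Suc m) a) {a..b}"
  proof (rule fundamental_theorem_of_calculus_interior)
    fix x assume x: "x \<in> {a<..<b}"
    have "((\<lambda>x. \<phi> m x * \<psi> (Suc m) x) has_real_derivative
        \<phi> (Suc m) x * \<psi> (Suc m) x - \<phi> m x * \<psi> m x) (at x)"
      by (rule derivative_eq_intros Suc.prems x lessI refl)+ (simp add: algebra_simps)
    thus "((\<lambda>x. \<phi> m x * \<psi> (Suc m) x) has_vector_derivative
        \<phi> (Suc m) x * \<psi> (Suc m) x - \<phi> m x * \<psi> m x) (at x)"
      by (simp add: has_real_derivative_iff_has_vector_derivative)
  qed (use Suc.prems in \<open>auto intro!: continuous_intros\<close>)
  hence "((\<lambda>x. \<phi> (Suc m) x * \<psi> (Suc m) x - \<phi> m x * \<psi> m x) has_integral 0) {a..b}"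
    using Suc.prems by simp
  moreover have "((\<lambda>x. \<phi> m x * \<psi> m x) has_integral I) {a..b}"
    by (rule Suc.IH; (rule Suc.prems; simp)?)
  ultimately have "((\<lambda>x. \<phi> (Suc m) x * \<psi> (Suc m) x - \<phi> m x * \<psi> m x + \<phi> m x * \<psi> m x) has_integral 0 + I) {a..b}"
    by (rule has_integral_add)
  thus ?case
    by simp
qed

text \<open>Integrating up to the right end makes every iterate of positive index vanish at
  \<open>b\<close>. Index 0 is the weight itself, which may be singular there.\<close>

primrec iterated_integral :: "(real \<Rightarrow> real) \<Rightarrow> real \<Rightarrow> nat \<Rightarrow> real \<Rightarrow> real" where
  "iterated_integral w b 0 = w"
| "iterated_integral w b (Suc k) = (\<lambda>u. integral {u..b} (iterated_integral w b k))"

lemma iterated_integral_integrable: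
  assumes "w integrable_on {a..b}"
  shows "iterated_integral w b k integrable_on {a..b}"
  by (induction k) (auto intro!: assms integrable_continuous_real indefinite_integral_continuous_1')

lemma continuous_on_iterated_integral:
  assumes "w integrable_on {a..b}"
  shows "continuous_on {a..b} (iterated_integral w b (Suc k))"
  using iterated_integral_integrable[OF assms] by (auto intro: indefinite_integral_continuous_1')

lemma iterated_integral_deriv:
  assumes w: "w integrable_on {a..b}" "continuous_on {a<..<b} w" and x: "x \<in> {a<..<b}"
  shows "(iterated_integral w b (Suc k) has_real_derivative - iterated_integral w b k x) (at x)"
proof -
  let ?g = "iterated_integral w b k"
  have int: "?g integrable_on {a..b}"
    using w by (intro iterated_integral_integrable)
  have "continuous_on {a<..<b} ?g"
  proof (cases k)
    case (Suc l)
    show ?thesis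
      unfolding Suc by (rule continuous_on_subset[OF continuous_on_iterated_integral[OF w(1)]]) auto
  qed (use w in simp)
  hence "isCont ?g x"
    using x by (simp add: continuous_on_eq_continuous_at)
  hence "((\<lambda>u. integral {a..u} ?g) has_vector_derivative ?g x) (at x within {a..b} - {})"
    using int x by (intro integral_has_vector_derivative_continuous_at)
      (auto intro: continuous_at_imp_continuous_at_within)
  hence "((\<lambda>u. integral {a..u} ?g) has_real_derivative ?g x) (at x)"
    using x by (simp add: has_real_derivative_iff_has_vector_derivative at_within_Icc_at)
  \<comment> \<open>The integral with moving lower limit is the total minus the one with moving
    upper limit, hence the minus sign.\<close>
  hence "((\<lambda>u. integral {a..b} ?g - integral {a..u} ?g) has_real_derivative - ?g x) (at x)"
    by (auto intro!: derivative_eq_intros)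
  moreover have "integral {a..b} ?g - integral {a..u} ?g = integral {u..b} ?g" if "u \<in> {a<..<b}" for u
    using Henstock_Kurzweil_Integration.integral_combine[OF _ _ int, of u] that by (simp add: algebra_simps)
  ultimately show ?thesis
    using x by (auto intro: has_field_derivative_transform_within_open[of _ _ _ "{a<..<b}"])
qed

text \<open>Dividing by the factorial absorbs the exponent, so such powers form a chain of
  derivatives as integration by parts requires.\<close>

lemma has_real_derivative_power_over_fact:
  fixes f :: "real \<Rightarrow> real"
  assumes "(f has_real_derivative f') (at x)"
  shows "((\<lambda>x. f x ^ Suc k / fact (Suc k)) has_real_derivative f' * (f x ^ k / fact k)) (at x)"
proof -
  have "((\<lambda>x. f x ^ Suc k / fact (Suc k)) has_real_derivative
      (1 + real k) * (f' * f x ^ k) / fact (Suc k)) (at x)"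
    using assms by (intro DERIV_cdivide DERIV_power_Suc)
  also have "(1 + real k) * (f' * f x ^ k) / fact (Suc k) = f' * (f x ^ k / fact k)"
    by (simp add: divide_simps)
  finally show ?thesis .
qed

text \<open>Cauchy's formula for repeated integration: integrating by parts from the right-hand side
  avoids differentiating under the integral sign.\<close>

lemma iterated_integral_Suc_eq:
  assumes w: "w absolutely_integrable_on {a..b}" "continuous_on {a<..<b} w" and u: "u \<in> {a..b}"
  shows "iterated_integral w b (Suc m) u = integral {u..b} (\<lambda>s. (s - u) ^ m / fact m * w s)"
proof -
  \<comment> \<open>The chain descends from \<open>(s - u) ^ m / fact m\<close> to the constant 1 at
    index \<open>m\<close>; before that the exponent is positive, so the value at \<open>u\<close>
    is 0.\<close>
  define \<phi> where "\<phi> k s = (s - u) ^ (m - k) / fact (m - k)" for k and s :: real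
  have wu: "w absolutely_integrable_on {u..b}"
    using u by (intro absolutely_integrable_on_subinterval[OF w(1)]) auto
  hence wi: "w integrable_on {u..b}"
    by (simp add: absolutely_integrable_on_def)
  have "(\<lambda>s. \<phi> 0 s * w s) absolutely_integrable_on {u..b}"
    using wu by (intro absolutely_integrable_continuous_mult)
      (auto simp: \<phi>_def intro!: continuous_intros)
  hence "(\<lambda>s. \<phi> 0 s * w s) integrable_on {u..b}"
    by (simp add: absolutely_integrable_on_def)
  hence "((\<lambda>s. \<phi> 0 s * iterated_integral w b 0 s) has_integral integral {u..b} (\<lambda>s. \<phi> 0 s * w s)) {u..b}"
    by (simp add: integrable_integral)
  hence "((\<lambda>s. \<phi> m s * iterated_integral w b m s) has_integral integral {u..b} (\<lambda>s. \<phi> 0 s * w s)) {u..b}"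
  proof (rule iterated_integration_by_parts[rotated -1])
    fix k x assume k: "k < m" and x: "x \<in> {u<..<b}"
    have k': "m - k = Suc (m - Suc k)"
      using k by simp
    show "(\<phi> k has_real_derivative \<phi> (Suc k) x) (at x)"
      unfolding \<phi>_def k'
      by (rule has_real_derivative_power_over_fact[where f' = 1, simplified mult_1])
         (auto intro!: derivative_eq_intros)
    show "(iterated_integral w b (Suc k) has_real_derivative - iterated_integral w b k x) (at x)"
      using wi x u by (intro iterated_integral_deriv) (auto intro: continuous_on_subset[OF w(2)])
  next
    fix k assume "k < m"
    show "continuous_on {u..b} (iterated_integral w b (Suc k))"
      by (rule continuous_on_iterated_integral[OF wi])
  qed (use u in \<open>auto simp: \<phi>_def intro!: continuous_intros\<close>)
  thus ?thesis
    by (simp add: \<phi>_def integral_unique)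
qed

section \<open>Taylor remainder and Taylor polynomial\<close>

text \<open>Taylor's formula at \<open>a\<close> with integral remainder, where the Taylor
  polynomial is zero. The truncated power extends the integral from \<open>{a..c}\<close> to
  \<open>{a..b}\<close>, so that all nodes share one domain.\<close>

lemma taylor_remainder_trunc_pow:
  fixes \<phi> :: "nat \<Rightarrow> real \<Rightarrow> real" and a b c :: real
  assumes c: "c \<in> {a..b}"
    and cont: "\<And>k. k \<le> m \<Longrightarrow> continuous_on {a..b} (\<phi> k)"
    and deriv: "\<And>k x. k \<le> m \<Longrightarrow> x \<in> {a<..<b} \<Longrightarrow> (\<phi> k has_real_derivative \<phi> (Suc k) x) (at x)"
    and zero: "\<And>k. k \<le> m \<Longrightarrow> \<phi> k a = 0"
  shows "((\<lambda>u. \<phi> (Suc m) u * (trunc_pow (c - u) m / fact m)) has_integral \<phi> 0 c) {a..b}"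
proof -
  define \<psi> where "\<psi> k u = (c - u) ^ k / fact k" for k and u :: real
  have "(\<phi> 1 has_integral \<phi> 0 c - \<phi> 0 a) {a..c}"
    using c deriv[of 0] continuous_on_subset[OF cont[of 0], of "{a..c}"]
    by (intro fundamental_theorem_of_calculus_interior)
       (auto simp: has_real_derivative_iff_has_vector_derivative[symmetric])
  hence "((\<lambda>u. \<phi> (Suc 0) u * \<psi> 0 u) has_integral \<phi> 0 c) {a..c}"
    using zero[of 0] by (simp add: \<psi>_def)
  hence "((\<lambda>u. \<phi> (Suc m) u * \<psi> m u) has_integral \<phi> 0 c) {a..c}"
  \<comment> \<open>The chain starts at \<open>\<phi> 1\<close>: one derivative was already used to
    write \<open>\<phi> 0 c\<close> as an integral.\<close>
  proof (rule iterated_integration_by_parts[where \<phi> = "\<lambda>k. \<phi> (Suc k)", rotated -1])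
    fix k x assume k: "k < m" and x: "x \<in> {a<..<c}"
    show "(\<phi> (Suc k) has_real_derivative \<phi> (Suc (Suc k)) x) (at x)"
      using k x c by (intro deriv) auto
    show "(\<psi> (Suc k) has_real_derivative - \<psi> k x) (at x)"
      unfolding \<psi>_def
      by (rule has_real_derivative_power_over_fact[where f' = "-1", simplified mult_minus1])
         (auto intro!: derivative_eq_intros)
  next
    fix k assume "k < m"
    thus "continuous_on {a..c} (\<phi> (Suc k))"
      using c by (intro continuous_on_subset[OF cont[of "Suc k"]]) auto
  qed (use c zero in \<open>auto simp: \<psi>_def intro!: continuous_intros\<close>)
  \<comment> \<open>Extension by zero; at \<open>u = c\<close> both sides use \<open>0 ^ m\<close>,
    which is 1 for \<open>m = 0\<close>.\<close>
  hence "((\<lambda>u. if u \<in> {a..c} then \<phi> (Suc m) u * \<psi> m u else 0) has_integral \<phi> 0 c) {a..b}"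
    using c has_integral_restrict_closed_subinterval[of _ "\<phi> 0 c" a c a b] by simp
  thus ?thesis
    by (rule has_integral_eq[rotated]) (auto simp: \<psi>_def trunc_pow_def)
qed

lemma exists_taylor_poly:
  fixes y :: "nat \<Rightarrow> real" and a :: real
  shows "\<exists>p. degree p \<le> m \<and> (\<forall>k\<le>m. poly ((pderiv ^^ k) p) a = y k)"
proof -
  define q where "q = (\<Sum>k\<le>m. monom (y k / fact k) k)"
  \<comment> \<open>The coefficients are prescribed at 0 and the polynomial is then shifted to
    \<open>a\<close>; the shift has derivative 1, so it commutes with \<open>pderiv\<close>.\<close>
  define p where "p = pcompose q [:- a, 1:]"
  have coeff_q: "coeff q k = (if k \<le> m then y k / fact k else 0)" for k
    by (auto simp: q_def coeff_sum)
  have "degree q \<le> m"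
    by (rule degree_le) (simp add: coeff_q)
  hence "degree p \<le> m"
    using degree_pcompose_le[of q "[:- a, 1:]"] by (simp add: p_def)
  moreover have "poly ((pderiv ^^ k) p) a = y k" if "k \<le> m" for k
  proof -
    have "(pderiv ^^ k) p = pcompose ((pderiv ^^ k) q) [:- a, 1:]"
      by (induction k) (simp_all add: p_def pderiv_pcompose pderiv_pCons)
    thus ?thesis
      using that by (simp add: poly_pcompose poly_0_coeff_0 coeff_higher_pderiv coeff_q flip: pochhammer_fact)
  qed
  ultimately show ?thesis
    by blast
qed

lemma higher_pderiv_eq_0:
  fixes p :: "real poly"
  assumes "degree p < k"
  shows "(pderiv ^^ k) p = 0"
  using assms by (intro poly_eqI) (simp add: coeff_higher_pderiv coeff_eq_0)

section \<open>Peano kernel of the quadrature error on one panel\<close>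

text \<open>The weighted integral is moved onto the top derivative by \<open>m + 1\<close>
  integrations by parts, each node value by its Taylor remainder. Both are then integrals over
  \<open>{a..b}\<close> with the common factor \<open>\<phi> (Suc m)\<close>.\<close>

lemma peano_kernel_error:
  fixes \<phi> :: "nat \<Rightarrow> real \<Rightarrow> real" and w :: "real \<Rightarrow> real" and a b :: real
  assumes "a \<le> b"
    and w: "w absolutely_integrable_on {a..b}" "continuous_on {a<..<b} w"
    and x: "\<And>r. r \<in> A \<Longrightarrow> x r \<in> {a..b}" "finite A"
    and cont: "\<And>k. k \<le> m \<Longrightarrow> continuous_on {a..b} (\<phi> k)"
    and deriv: "\<And>k x. k \<le> m \<Longrightarrow> x \<in> {a<..<b} \<Longrightarrow> (\<phi> k has_real_derivative \<phi> (Suc k) x) (at x)"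
    and zero: "\<And>k. k \<le> m \<Longrightarrow> \<phi> k a = 0"
  shows "((\<lambda>u. \<phi> (Suc m) u * (integral {u..b} (\<lambda>s. (s - u) ^ m / fact m * w s) -
            (\<Sum>r\<in>A. \<beta> r * (trunc_pow (x r - u) m / fact m)))) has_integral
          (integral {a..b} (\<lambda>s. \<phi> 0 s * w s) - (\<Sum>r\<in>A. \<beta> r * \<phi> 0 (x r)))) {a..b}"
proof -
  have wi: "w integrable_on {a..b}"
    using w(1) by (simp add: absolutely_integrable_on_def)
  have "(\<lambda>s. \<phi> 0 s * w s) absolutely_integrable_on {a..b}"
    using w(1) cont[of 0] by (intro absolutely_integrable_continuous_mult) auto
  hence "((\<lambda>s. \<phi> 0 s * iterated_integral w b 0 s) has_integral integral {a..b} (\<lambda>s. \<phi> 0 s * w s)) {a..b}"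
    by (simp add: absolutely_integrable_on_def integrable_integral)
  hence "((\<lambda>u. \<phi> (Suc m) u * iterated_integral w b (Suc m) u) has_integral
      integral {a..b} (\<lambda>s. \<phi> 0 s * w s)) {a..b}"
  proof (rule iterated_integration_by_parts[rotated -1])
    fix k x assume k: "k < Suc m" and x: "x \<in> {a<..<b}"
    show "(\<phi> k has_real_derivative \<phi> (Suc k) x) (at x)"
      using k x by (intro deriv) auto
    show "(iterated_integral w b (Suc k) has_real_derivative - iterated_integral w b k x) (at x)"
      by (rule iterated_integral_deriv[OF wi w(2) x])
  next
    fix k assume "k < Suc m"
    show "continuous_on {a..b} (iterated_integral w b (Suc k))"
      by (rule continuous_on_iterated_integral[OF wi])
  qed (use \<open>a \<le> b\<close> cont zero in auto)
  hence "((\<lambda>u. \<phi> (Suc m) u * integral {u..b} (\<lambda>s. (s - u) ^ m / fact m * w s)) has_integral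
      integral {a..b} (\<lambda>s. \<phi> 0 s * w s)) {a..b}"
    by (rule has_integral_eq[rotated]) (simp only: iterated_integral_Suc_eq[OF w])
  moreover have "((\<lambda>u. \<Sum>r\<in>A. \<beta> r * (\<phi> (Suc m) u * (trunc_pow (x r - u) m / fact m))) has_integral
      (\<Sum>r\<in>A. \<beta> r * \<phi> 0 (x r))) {a..b}"
    using x by (intro has_integral_sum has_integral_mult_right taylor_remainder_trunc_pow cont deriv zero)
  ultimately have "((\<lambda>u. \<phi> (Suc m) u * integral {u..b} (\<lambda>s. (s - u) ^ m / fact m * w s) -
      (\<Sum>r\<in>A. \<beta> r * (\<phi> (Suc m) u * (trunc_pow (x r - u) m / fact m)))) has_integral
      (integral {a..b} (\<lambda>s. \<phi> 0 s * w s) - (\<Sum>r\<in>A. \<beta> r * \<phi> 0 (x r)))) {a..b}"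
    by (rule has_integral_diff)
  thus ?thesis
    by (simp add: right_diff_distrib sum_distrib_left mult_ac)
qed

text \<open>The panel is mapped to the unit interval by \<open>s = a + u * h\<close>, and the Peano
  kernel is applied to the Taylor error. \<open>N\<close> is the distance from \<open>a\<close> to
  the evaluation point in steps; \<open>N \<ge> 1\<close> puts the singularity of the weight at or
  beyond the right end.\<close>

lemma ml_quadrature_error:
  fixes \<alpha> \<mu> h a N :: real and F :: "nat \<Rightarrow> real \<Rightarrow> real"
  assumes "\<alpha> > 0" "h > 0" "N \<ge> 1"
    and A: "\<And>r. r \<in> A \<Longrightarrow> c r \<in> {0..1}" "finite A"
    and cont: "\<And>k. k \<le> d \<Longrightarrow> continuous_on {a..a + h} (F k)"
    and deriv: "\<And>k x. k \<le> d \<Longrightarrow> x \<in> {a<..<a + h} \<Longrightarrow> (F k has_real_derivative F (Suc k) x) (at x)"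
    and exact: "\<And>p. degree p \<le> d \<Longrightarrow>
      integral {a..a + h} (\<lambda>s. ml_e \<alpha> \<alpha> (a + N * h - s) \<mu> * poly p s) = (\<Sum>r\<in>A. \<beta> r * poly p (a + c r * h))"
  shows "(\<lambda>u. F (Suc d) (a + u * h) * (h powr \<alpha> * ml_R \<alpha> \<alpha> d N u 1 (h powr \<alpha> * \<mu>) -
            (\<Sum>r\<in>A. \<beta> r * (trunc_pow (c r - u) d / fact d)))) integrable_on {0..1}" (is "?K integrable_on _")
    and "h ^ Suc d * integral {0..1} (\<lambda>u. F (Suc d) (a + u * h) * (h powr \<alpha> * ml_R \<alpha> \<alpha> d N u 1 (h powr \<alpha> * \<mu>) -
            (\<Sum>r\<in>A. \<beta> r * (trunc_pow (c r - u) d / fact d)))) =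
           integral {a..a + h} (\<lambda>s. ml_e \<alpha> \<alpha> (a + N * h - s) \<mu> * F 0 s) - (\<Sum>r\<in>A. \<beta> r * F 0 (a + c r * h))"
proof -
  define e where "e s = ml_e \<alpha> \<alpha> (a + N * h - s) \<mu>" for s
  define X where "X = integral {a..a + h} (\<lambda>s. e s * F 0 s) - (\<Sum>r\<in>A. \<beta> r * F 0 (a + c r * h))"
  \<comment> \<open>This is \<open>h * e (a + u * h)\<close>: the Jacobian \<open>h\<close> and the
    factor \<open>h powr (\<alpha> - 1)\<close> from scaling combine to
    \<open>h powr \<alpha>\<close>.\<close>
  define w where "w u = h powr \<alpha> * ml_e \<alpha> \<alpha> (N - u) (h powr \<alpha> * \<mu>)" for u
  obtain p where p: "degree p \<le> d" "\<And>k. k \<le> d \<Longrightarrow> poly ((pderiv ^^ k) p) a = F k a"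
    using exists_taylor_poly[of d a "\<lambda>k. F k a"] by blast
  \<comment> \<open>Derivatives of the Taylor error in the variable \<open>u\<close>; the chain rule
    contributes \<open>h ^ k\<close>. At index \<open>d + 1\<close> the polynomial drops out by its
    degree.\<close>
  define \<phi> where "\<phi> k u = h ^ k * (F k (a + u * h) - poly ((pderiv ^^ k) p) (a + u * h))" for k u
  have \<phi>_Suc_d: "\<phi> (Suc d) u = h ^ Suc d * F (Suc d) (a + u * h)" for u
    using higher_pderiv_eq_0[of p "Suc d"] p by (simp add: \<phi>_def del: funpow.simps)
  have R: "integral {u..1} (\<lambda>s. (s - u) ^ d / fact d * w s) = h powr \<alpha> * ml_R \<alpha> \<alpha> d N u 1 (h powr \<alpha> * \<mu>)" for u
  proof -
    have "(\<lambda>s. (s - u) ^ d / fact d * w s) =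
        (\<lambda>s. h powr \<alpha> / fact d * (ml_e \<alpha> \<alpha> (N - s) (h powr \<alpha> * \<mu>) * (s - u) ^ d))"
      by (simp add: w_def fun_eq_iff)
    thus ?thesis
      by (simp add: ml_R_def Gamma_fact add.commute[of _ 1])
  qed
  have w: "w absolutely_integrable_on {0..1}" "continuous_on {0<..<1} w"
  proof -
    show "w absolutely_integrable_on {0..1}"
      unfolding w_def using assms
      by (intro absolutely_integrable_continuous_mult absolutely_integrable_reflected_ml_e continuous_intros)
    show "continuous_on {0<..<1} w"
      unfolding w_def using assms
      by (intro continuous_intros continuous_on_compose2[OF continuous_on_ml_e[of \<alpha> "{0<..}"]]) auto
  qed
  have affine: "a + u * h \<in> {a..a + h}" if "u \<in> {0..1}" for u
    using that assms by (auto simp: mult_le_cancel_right1)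
  have \<phi>_cont: "continuous_on {0..1} (\<phi> k)" if "k \<le> d" for k
    unfolding \<phi>_def using affine
    by (intro continuous_intros continuous_on_compose2[OF cont[OF that]]) auto
  have kernel: "((\<lambda>u. \<phi> (Suc d) u * (integral {u..1} (\<lambda>s. (s - u) ^ d / fact d * w s) -
        (\<Sum>r\<in>A. \<beta> r * (trunc_pow (c r - u) d / fact d)))) has_integral
      (integral {0..1} (\<lambda>s. \<phi> 0 s * w s) - (\<Sum>r\<in>A. \<beta> r * \<phi> 0 (c r)))) {0..1}"
  proof (rule peano_kernel_error)
    fix k assume k: "k \<le> d"
    show "continuous_on {0..1} (\<phi> k)"
      by (rule \<phi>_cont[OF k])
    show "\<phi> k 0 = 0"
      using p k by (simp add: \<phi>_def)
    fix u :: real assume u: "u \<in> {0<..<1}"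
    have "a + u * h \<in> {a<..<a + h}"
      using u assms by auto
    hence "((\<lambda>u. F k (a + u * h)) has_real_derivative F (Suc k) (a + u * h) * h) (at u)"
      by (intro DERIV_chain2[OF deriv[OF k]]) (auto intro!: derivative_eq_intros)
    moreover have "((\<lambda>u. poly ((pderiv ^^ k) p) (a + u * h)) has_real_derivative
        poly ((pderiv ^^ Suc k) p) (a + u * h) * h) (at u)"
      unfolding funpow.simps o_apply
      by (intro DERIV_chain2[OF poly_DERIV]) (auto intro!: derivative_eq_intros)
    ultimately show "(\<phi> k has_real_derivative \<phi> (Suc k) u) (at u)"
      unfolding \<phi>_def
      by (intro DERIV_cong[OF DERIV_cmult[OF DERIV_diff]]) (auto simp: algebra_simps simp del: funpow.simps)
  qed (use w A in auto)
  have e: "e absolutely_integrable_on {a..a + h}"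
    unfolding e_def using assms by (intro absolutely_integrable_reflected_ml_e) auto
  have e_mult: "(\<lambda>s. e s * g s) integrable_on {a..a + h}" if "continuous_on {a..a + h} g" for g
    using absolutely_integrable_continuous_mult[OF that e]
    by (simp add: absolutely_integrable_on_def mult.commute)
  have "((\<lambda>s. \<phi> 0 s * w s) has_integral integral {0..1} (\<lambda>s. \<phi> 0 s * w s)) (cbox 0 1)"
    using absolutely_integrable_continuous_mult[OF \<phi>_cont w(1), of 0]
    by (simp add: absolutely_integrable_on_def integrable_integral)
  \<comment> \<open>Substitution \<open>u = s / h - a / h\<close> back to the original
    panel.\<close>
  hence "((\<lambda>s. \<phi> 0 ((1 / h) *\<^sub>R s + - (a / h)) * w ((1 / h) *\<^sub>R s + - (a / h))) has_integral
      integral {0..1} (\<lambda>s. \<phi> 0 s * w s) /\<^sub>R (1 / h) ^ DIM(real))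
      (cbox ((0 - - (a / h)) /\<^sub>R (1 / h)) ((1 - - (a / h)) /\<^sub>R (1 / h)))"
    by (rule has_integral_affinity') (use assms in simp)
  hence "((\<lambda>s. \<phi> 0 (s / h - a / h) * w (s / h - a / h)) has_integral
      h * integral {0..1} (\<lambda>s. \<phi> 0 s * w s)) {a..a + h}"
    using assms(2) by (simp add: distrib_left add.commute)
  hence "((\<lambda>s. h * (e s * (F 0 s - poly p s))) has_integral h * integral {0..1} (\<lambda>s. \<phi> 0 s * w s)) {a..a + h}"
  proof (rule has_integral_eq[rotated])
    fix s assume s: "s \<in> {a..a + h}"
    let ?u = "s / h - a / h"
    have "?u \<le> 1"
      using s assms by (simp add: field_simps)
    hence "ml_e \<alpha> \<alpha> (h * (N - ?u)) \<mu> = h powr (\<alpha> - 1) * ml_e \<alpha> \<alpha> (N - ?u) (h powr \<alpha> * \<mu>)"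
      using assms by (intro ml_e_scale) auto
    moreover have "h * (N - ?u) = a + N * h - s"
      using assms by (simp add: field_simps)
    moreover have "h * h powr (\<alpha> - 1) = h powr \<alpha>"
      using assms by (simp add: powr_diff)
    ultimately have "h * e s = w ?u"
      by (simp add: e_def w_def mult.assoc[symmetric])
    moreover have "\<phi> 0 ?u = F 0 s - poly p s"
      using assms by (simp add: \<phi>_def algebra_simps)
    ultimately show "\<phi> 0 ?u * w ?u = h * (e s * (F 0 s - poly p s))"
      by simp
  qed
  hence "((\<lambda>s. e s * (F 0 s - poly p s)) has_integral h * integral {0..1} (\<lambda>s. \<phi> 0 s * w s) / h) {a..a + h}"
    by (rule has_integral_mult_right_iff[THEN iffD1, rotated]) (use assms(2) in simp)
  hence "integral {0..1} (\<lambda>s. \<phi> 0 s * w s) = integral {a..a + h} (\<lambda>s. e s * F 0 s - e s * poly p s)"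
    using assms(2) by (simp add: right_diff_distrib integral_unique)
  also have "\<dots> = integral {a..a + h} (\<lambda>s. e s * F 0 s) - integral {a..a + h} (\<lambda>s. e s * poly p s)"
    using cont[of 0] by (intro Henstock_Kurzweil_Integration.integral_diff e_mult continuous_intros) auto
  \<comment> \<open>Exactness makes the integral of \<open>p\<close> equal to its node sum, so
    \<open>p\<close> cancels and the error of \<open>F 0\<close> remains.\<close>
  also have "integral {a..a + h} (\<lambda>s. e s * poly p s) = (\<Sum>r\<in>A. \<beta> r * poly p (a + c r * h))"
    using exact[OF p(1)] by (simp add: e_def)
  finally have X: "integral {0..1} (\<lambda>s. \<phi> 0 s * w s) - (\<Sum>r\<in>A. \<beta> r * \<phi> 0 (c r)) = X"
    by (simp add: X_def \<phi>_def right_diff_distrib sum_subtractf)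
  have "((\<lambda>u. h ^ Suc d * (F (Suc d) (a + u * h) *
        (h powr \<alpha> * ml_R \<alpha> \<alpha> d N u 1 (h powr \<alpha> * \<mu>) - (\<Sum>r\<in>A. \<beta> r * (trunc_pow (c r - u) d / fact d))))) has_integral X) {0..1}"
    using kernel by (simp only: \<phi>_Suc_d R X mult.assoc)
  hence K: "(?K has_integral X / h ^ Suc d) {0..1}"
    by (rule has_integral_mult_right_iff[THEN iffD1, rotated]) (use assms(2) in simp)
  show "?K integrable_on {0..1}"
    using K by (rule has_integral_integrable)
  have "h ^ Suc d * integral {0..1} ?K = X"
    unfolding integral_unique[OF K] using assms(2) by simp
  thus "h ^ Suc d * integral {0..1} ?K =
      integral {a..a + h} (\<lambda>s. ml_e \<alpha> \<alpha> (a + N * h - s) \<mu> * F 0 s) - (\<Sum>r\<in>A. \<beta> r * F 0 (a + c r * h))"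
    unfolding X_def e_def .
qed

section \<open>Summation over the mesh\<close>

lemma mesh_Suc: "mesh t0 h (Suc j) = mesh t0 h j + h"
  by (simp add: mesh_def algebra_simps)

lemma mesh_mono: "h \<ge> 0 \<Longrightarrow> i \<le> j \<Longrightarrow> mesh t0 h i \<le> mesh t0 h j"
  by (simp add: mesh_def mult_right_mono)

lemma integral_mesh_sum:
  fixes g :: "real \<Rightarrow> real"
  assumes "h \<ge> 0" "g integrable_on {t0..mesh t0 h n}"
  shows "integral {t0..mesh t0 h n} g = (\<Sum>j<n. integral {mesh t0 h j..mesh t0 h (Suc j)} g)"
  using assms(2)
proof (induction n)
  case 0
  thus ?case by (simp add: mesh_def)
next
  case (Suc n)
  have mesh: "t0 \<le> mesh t0 h n" "mesh t0 h n \<le> mesh t0 h (Suc n)"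
    using assms(1) mesh_mono[of h 0 n t0] mesh_mono[of h n "Suc n" t0] by (auto simp: mesh_def)
  have "g integrable_on {t0..mesh t0 h n}"
    by (rule integrable_subinterval_real[OF Suc.prems]) (use mesh in auto)
  thus ?case
    using Suc.IH Henstock_Kurzweil_Integration.integral_combine[OF mesh Suc.prems] by simp
qed

text \<open>Inside \<open>S\<close> the derivative within \<open>S\<close> is the two-sided one, and
  differentiability ensures that \<open>vector_derivative\<close> denotes a true derivative.\<close>

lemma nth_deriv_within_deriv:
  fixes f :: "real \<Rightarrow> real"
  assumes "nth_deriv_within k f S differentiable_on U" "open U" "U \<subseteq> S" "x \<in> U"
  shows "(nth_deriv_within k f S has_real_derivative nth_deriv_within (Suc k) f S x) (at x)"
proof -
  have "at x within S = at x"
    using assms(2-4) by (intro at_within_interior) (auto simp: interior_def)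
  moreover have "nth_deriv_within k f S differentiable (at x)"
    using assms by (auto simp: differentiable_on_eq_differentiable_at)
  ultimately show ?thesis
    by (simp add: has_real_derivative_iff_has_vector_derivative vector_derivative_works)
qed

lemma C_k_on_continuous_on:
  assumes "C_k_on d f S" "k \<le> d"
  shows "continuous_on S (nth_deriv_within k f S)"
  using assms by (cases "k = d") (auto simp: C_k_on_def intro: differentiable_imp_continuous_on)

text \<open>The first conjunct asserts that the integrals on the right exist, since
  \<open>integral\<close> is 0 by default for a function that is not integrable.\<close>

theorem proposition4p1:
  fixes \<alpha> \<mu> t0 T h :: real and n d \<nu> :: nat
    and y0 c :: "nat \<Rightarrow> real" and b :: "nat \<Rightarrow> nat \<Rightarrow> real" and f :: "real \<Rightarrow> real"
  assumes "\<alpha> > 0" and "t0 < T" and "h > 0" and "n \<ge> 1" and "mesh t0 h n \<le> T"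
    and "\<forall>r\<in>{1..\<nu>}. c r \<in> {0..1}"
    and "C_k_on d f {t0..T}"
    and "\<forall>j<n. nth_deriv_within d f {t0..T} differentiable_on {mesh t0 h j<..<mesh t0 h (Suc j)}"
    and "\<forall>j<n. continuous_on {mesh t0 h j<..<mesh t0 h (Suc j)} (nth_deriv_within (d + 1) f {t0..T})"
    and "\<forall>j<n. degree_of_precision (quad_integral \<alpha> \<mu> t0 h n j) (quad_rule \<nu> c b t0 h n j) d"
  shows "(\<forall>j<n. (\<lambda>u. nth_deriv_within (d + 1) f {t0..T} (mesh t0 h j + u * h) *
              (h powr \<alpha> * ml_R \<alpha> \<alpha> d (real (n - j)) u 1 (h powr \<alpha> * \<mu>) -
               (\<Sum>r=1..\<nu>. b r (n - j) * (trunc_pow (c r - u) d / fact d)))) integrable_on {0..1})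
     \<and> fde_solution \<alpha> \<mu> t0 y0 f (mesh t0 h n) - numerical_solution \<alpha> \<mu> t0 y0 \<nu> c b h f n =
         h ^ (d + 1) * (\<Sum>j<n. integral {0..1}
           (\<lambda>u. nth_deriv_within (d + 1) f {t0..T} (mesh t0 h j + u * h) *
              (h powr \<alpha> * ml_R \<alpha> \<alpha> d (real (n - j)) u 1 (h powr \<alpha> * \<mu>) -
               (\<Sum>r=1..\<nu>. b r (n - j) * (trunc_pow (c r - u) d / fact d)))))"
proof -
  let ?F = "\<lambda>k. nth_deriv_within k f {t0..T}"
  let ?t = "mesh t0 h"
  let ?e = "\<lambda>s. ml_e \<alpha> \<alpha> (?t n - s) \<mu>"
  let ?K = "\<lambda>j u. ?F (d + 1) (?t j + u * h) *
    (h powr \<alpha> * ml_R \<alpha> \<alpha> d (real (n - j)) u 1 (h powr \<alpha> * \<mu>) -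
     (\<Sum>r=1..\<nu>. b r (n - j) * (trunc_pow (c r - u) d / fact d)))"
  let ?Q = "\<lambda>j. \<Sum>r=1..\<nu>. b r (n - j) * f (?t j + c r * h)"
  have t0: "?t 0 = t0"
    by (simp add: mesh_def)
  have panel: "?K j integrable_on {0..1}"
    "h ^ (d + 1) * integral {0..1} (?K j) = integral {?t j..?t (Suc j)} (\<lambda>s. ?e s * f s) - ?Q j" if j: "j < n" for j
  proof -
    have "t0 \<le> ?t j" "?t (Suc j) \<le> ?t n"
      using \<open>h > 0\<close> mesh_mono[of h 0 j t0] mesh_mono[of h "Suc j" n t0] j by (auto simp: t0)
    hence sub: "{?t j..?t j + h} \<subseteq> {t0..T}" "{?t j<..<?t j + h} \<subseteq> {t0..T}"
      using \<open>?t n \<le> T\<close> by (auto simp: mesh_Suc)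
    \<comment> \<open>Seen from the panel starting at \<open>?t j\<close>, the evaluation point lies
      \<open>n - j\<close> steps ahead; this is the \<open>N\<close> of the panel estimate.\<close>
    have n: "?t j + real (n - j) * h = ?t n"
      using j by (simp add: mesh_def of_nat_diff algebra_simps)
    have exact: "integral {?t j..?t j + h} (\<lambda>s. ?e s * poly p s) =
        (\<Sum>r=1..\<nu>. b r (n - j) * poly p (?t j + c r * h))" if "degree p \<le> d" for p
      using assms(10) j that
      by (auto simp: degree_of_precision_def quad_integral_def quad_rule_def mesh_Suc)
    have deriv: "(?F k has_real_derivative ?F (Suc k) x) (at x)"
      if "k \<le> d" "x \<in> {?t j<..<?t j + h}" for k x
    proof (rule nth_deriv_within_deriv)
      show "?F k differentiable_on {?t j<..<?t j + h}"
      \<comment> \<open>Orders below \<open>d\<close> are differentiable on all of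
        \<open>{t0..T}\<close>; order \<open>d\<close> only within each open panel.\<close>
      proof (cases "k = d")
        case True
        thus ?thesis
          using assms(8) j by (simp add: mesh_Suc)
      next
        case False
        hence "?F k differentiable_on {t0..T}"
          using assms(7) that by (simp add: C_k_on_def)
        thus ?thesis
          using sub(2) by (rule differentiable_on_subset)
      qed
    qed (use sub that in auto)
    have cont: "continuous_on {?t j..?t j + h} (?F k)" if "k \<le> d" for k
      using C_k_on_continuous_on[OF assms(7) that] sub(1) by (rule continuous_on_subset)
    have nodes: "c r \<in> {0..1}" if "r \<in> {1..\<nu>}" for r
      using assms(6) that by blast
    have N: "real (n - j) \<ge> 1"
      using j by simp
    note error = ml_quadrature_error[where F = ?F and h = h and a = "?t j" and N = "real (n - j)" and \<mu> = \<mu>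
        and \<beta> = "\<lambda>r. b r (n - j)" and A = "{1..\<nu>}" and c = c and d = d,
        unfolded n nth_deriv_within.simps(1), OF assms(1,3) N]
    show "?K j integrable_on {0..1}"
      unfolding Suc_eq_plus1[symmetric]
      by (rule error) (fact nodes finite_atLeastAtMost cont deriv exact)+
    show "h ^ (d + 1) * integral {0..1} (?K j) = integral {?t j..?t (Suc j)} (\<lambda>s. ?e s * f s) - ?Q j"
      unfolding Suc_eq_plus1[symmetric] mesh_Suc
      by (rule error) (fact nodes finite_atLeastAtMost cont deriv exact)+
  qed
  have "continuous_on {t0..?t n} f"
    using continuous_on_subset[OF C_k_on_continuous_on[OF assms(7), of 0], of "{t0..?t n}"] \<open>?t n \<le> T\<close>
    by simp
  hence "(\<lambda>s. f s * ?e s) absolutely_integrable_on {t0..?t n}"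
    using \<open>\<alpha> > 0\<close> by (intro absolutely_integrable_continuous_mult absolutely_integrable_reflected_ml_e) auto
  hence "(\<lambda>s. ?e s * f s) integrable_on {t0..?t n}"
    by (simp add: absolutely_integrable_on_def mult.commute)
  hence "integral {t0..?t n} (\<lambda>s. ?e s * f s) = (\<Sum>j<n. integral {?t j..?t (Suc j)} (\<lambda>s. ?e s * f s))"
    using \<open>h > 0\<close> by (intro integral_mesh_sum) auto
  \<comment> \<open>The initial-value terms of the exact and numerical solutions agree and
    cancel.\<close>
  hence "fde_solution \<alpha> \<mu> t0 y0 f (?t n) - numerical_solution \<alpha> \<mu> t0 y0 \<nu> c b h f n =
      (\<Sum>j<n. integral {?t j..?t (Suc j)} (\<lambda>s. ?e s * f s) - ?Q j)"
    by (simp add: fde_solution_def numerical_solution_def sum_subtractf)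
  also have "\<dots> = h ^ (d + 1) * (\<Sum>j<n. integral {0..1} (?K j))"
    unfolding sum_distrib_left by (intro sum.cong refl panel(2)[symmetric]) simp
  finally show ?thesis
    using panel(1) by blast
qed

end
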